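(* Let $f$ be a dynamic equilibrium with earliest-time functions $\ell_v$ and cumulative flow $x=(x_e)_{e\in E}$, and let $\theta\in\mathbb R$ be such that the right derivatives $u_0=\frac{dU}{d\theta^+}(\theta)$, $\ell'_v=\frac{d\ell_v}{d\theta^+}(\theta)$ for all $v\in V$, and $x'_e=\frac{dx_e}{d\theta^+}(\theta)$ for all $e\in E$ exist. Then $x'=(x'_e)_{e\in E}$ is a normalized thin flow of value $u_0$ with resetting on $E^*_\theta\subseteq E'_\theta$, with corresponding labels $\ell'=(\ell'_v)_{v\in V}$.
   Context: Network. $G=(V,E)$ is a finite directed graph without loops and with at most one edge from $v$ to $w$ for every pair of nodes; an edge from $v$ to $w$ is written $e=vw$, and $\delta^+(v),\delta^-(v)$ are the sets of edges leaving and entering $v$. Each edge has a service rate $\nu_e>0$ and a travel time $\tau_e\ge 0$. There are a source $s$ and a sink $t\neq s$; every node is reachable from $s$ by a directed path; and $\sum_{e\in C}\tau_e>0$ for every directed cycle $C$. $\mathcal F_0(\mathbb R)$ is the set of nonnegative locally integrable functions on $\mathbb R$ that vanish a.e. on $(-\infty,0)$. The inflow rate is $u\in\mathcal F_0(\mathbb R)$, and $U(\theta)=\int_0^\theta u(\xi)\,d\xi$. Flows over time. A flow-over-time is a pair $f=(f^+,f^-)$ of arrays of functions $f_e^+,f_e^-\in\mathcal F_0(\mathbb R)$, $e\in E$. Put $F_e^\pm(\theta)=\int_0^\theta f_e^\pm(\xi)\,d\xi$ and $z_e(\theta)=F_e^+(\theta)-F_e^-(\theta+\tau_e)$ (queue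 size). $f$ is feasible if for almost all $\theta$: $f_e^-(\theta)\le\nu_e$ and $z_e(\theta)\ge0$ for each $e$, and $\sum_{e\in\delta^+(v)}f_e^+(\theta)-\sum_{e\in\delta^-(v)}f_e^-(\theta)$ equals $u(\theta)$ for $v=s$ and $0$ for $v\in V\setminus\{s,t\}$. It is always assumed that queues operate at capacity: for each $e$ and almost all $\theta$, $f_e^-(\theta+\tau_e)=\nu_e$ if $z_e(\theta)>0$ and $f_e^-(\theta+\tau_e)=\min\{f_e^+(\theta),\nu_e\}$ otherwise. Travel times. $T_e(\theta)=\theta+z_e(\theta)/\nu_e+\tau_e$. For a directed path $P=(e_1,\dots,e_k)$, $\ell^P(\theta)=T_{e_k}\circ\cdots\circ T_{e_1}(\theta)$. The earliest-time functions are $\ell_w(\theta)=\min_{P}\ell^P(\theta)$ over all directed $s$-$w$ paths $P$, with $\ell_s(\theta)=\theta$. An edge $e=vw$ is active at $\theta$, written $e\in E'_\theta$, if $T_e(\ell_v(\theta))\le\ell_w(\theta)$ (equivalently, equality holds); $\Theta_e=\{\theta\in\mathbb R: e\in E'_\theta\}$. Also $E^*_\theta=\{e=vw\in E: z_e(\ell_v(\theta))>0\}$. Equilibrium. A feasible flow-over-time $f$ is a dynamic equilibrium if for each $e=vw\in E$ we have $f_e^+(\xi)=0$ for almost all $\xi\in\ell_v(\mathbb R\setminus\Theta_e)$. For a dynamic equilibrium one has $E^*_\theta\subseteq E'_\theta$, $E'_\theta$ is acyclic and contains an $s$-$v$ path for every $v$, and $F_e^+(\ell_v(\theta))=F_e^-(\ell_w(\theta))$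 for all $e=vw$ and all $\theta$; the cumulative flow is $x_e(\theta)=F_e^+(\ell_v(\theta))=F_e^-(\ell_w(\theta))$. Normalized thin flows. Let $u_0\ge 0$ and $E^*\subseteq E'\subseteq E$ with $E'$ acyclic and containing an $s$-$v$ path for every $v\in V$. $K(E',u_0)$ is the set of vectors $x'=(x'_e)_{e\in E}\ge 0$ with $x'_e=0$ for $e\notin E'$ and $\sum_{e\in\delta^+(v)}x'_e-\sum_{e\in\delta^-(v)}x'_e$ equal to $u_0$ for $v=s$, $-u_0$ for $v=t$, and $0$ otherwise. For $e=vw\in E'$ set $\rho_e(a,b)=b/\nu_e$ if $e\in E^*$ and $\rho_e(a,b)=\max\{a,b/\nu_e\}$ if $e\notin E^*$. The labels corresponding to $x'\in K(E',u_0)$ are the unique $(\ell'_v)_{v\in V}$ with $\ell'_s=1$ and $\ell'_w=\min_{e=vw\in E'}\rho_e(\ell'_v,x'_e)$ for $w\ne s$. A flow $x'\in K(E',u_0)$ with labels $\ell'$ is a normalized thin flow of value $u_0$ with resetting on $E^*\subseteq E'$ if $x'_e=0$ for every $e=vw\in E'$ with $\ell'_w<\rho_e(\ell'_v,x'_e)$. *)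

theory Defs
  imports "HOL-Analysis.Analysis" "Graph_Theory.Graph_Theory"
begin

section \<open>Networks\<close>

record ('v, 'e) fluid_network =
  graph_of :: "('v, 'e) pre_digraph"
  source :: 'v
  sink :: 'v
  capacity :: "'e \<Rightarrow> real"
  delay :: "'e \<Rightarrow> real"

definition valid_network :: "('v, 'e) fluid_network \<Rightarrow> bool" where
  "valid_network N \<longleftrightarrow>
     digraph (graph_of N) \<and>
     source N \<in> verts (graph_of N) \<and> sink N \<in> verts (graph_of N) \<and> sink N \<noteq> source N \<and>
     (\<forall>e\<in>arcs (graph_of N). capacity N e > 0 \<and> delay N e \<ge> 0) \<and>
     (\<forall>v\<in>verts (graph_of N). source N \<rightarrow>\<^sup>*\<^bsub>graph_of N\<^esub> v) \<and>
     (\<forall>C. pre_digraph.cycle (graph_of N) C \<longrightarrow> (\<Sum>e\<in>set C. delay N e) > 0)"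

section \<open>Flows over time\<close>

text \<open>Measurability and null sets are taken in the Lebesgue sense.\<close>

definition rate_functions :: "(real \<Rightarrow> real) set" where
  "rate_functions =
     {g. (\<forall>\<xi>. g \<xi> \<ge> 0) \<and> (\<forall>a b. set_integrable lebesgue {a..b} g) \<and>
         (AE \<xi> in lebesgue. \<xi> < 0 \<longrightarrow> g \<xi> = 0)}"

text \<open>The interval integral is oriented, so this is the usual integral from \<open>0\<close> to \<open>\<theta>\<close>
  for negative \<open>\<theta>\<close> as well.\<close>

definition cumulative :: "(real \<Rightarrow> real) \<Rightarrow> real \<Rightarrow> real" where
  "cumulative g \<theta> = (LINT \<xi>=0..\<theta>|lebesgue. g \<xi>)"

text \<open>A flow over time is the pair of its inflow and outflow rate arrays.\<close>

type_synonym 'e flow_over_time = "('e \<Rightarrow> real \<Rightarrow> real) \<times> ('e \<Rightarrow> real \<Rightarrow> real)"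

definition queue :: "('v, 'e) fluid_network \<Rightarrow> 'e flow_over_time \<Rightarrow> 'e \<Rightarrow> real \<Rightarrow> real" where
  "queue N f e \<theta> = cumulative (fst f e) \<theta> - cumulative (snd f e) (\<theta> + delay N e)"

definition feasible :: "('v, 'e) fluid_network \<Rightarrow> (real \<Rightarrow> real) \<Rightarrow> 'e flow_over_time \<Rightarrow> bool" where
  "feasible N u f \<longleftrightarrow>
     (\<forall>e\<in>arcs (graph_of N). fst f e \<in> rate_functions \<and> snd f e \<in> rate_functions) \<and>
     (AE \<theta> in lebesgue.
        (\<forall>e\<in>arcs (graph_of N). snd f e \<theta> \<le> capacity N e \<and> queue N f e \<theta> \<ge> 0) \<and>
        (\<forall>v\<in>verts (graph_of N) - {sink N}.
           (\<Sum>e\<in>out_arcs (graph_of N) v. fst f e \<theta>) - (\<Sum>e\<in>in_arcs (graph_of N) v. snd f e \<theta>)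
             = (if v = source N then u \<theta> else 0)))"

definition queues_at_capacity :: "('v, 'e) fluid_network \<Rightarrow> 'e flow_over_time \<Rightarrow> bool" where
  "queues_at_capacity N f \<longleftrightarrow>
     (\<forall>e\<in>arcs (graph_of N). AE \<theta> in lebesgue.
        snd f e (\<theta> + delay N e) =
          (if queue N f e \<theta> > 0 then capacity N e else min (fst f e \<theta>) (capacity N e)))"


section \<open>Travel times and dynamic equilibria\<close>

definition exit_time :: "('v, 'e) fluid_network \<Rightarrow> 'e flow_over_time \<Rightarrow> 'e \<Rightarrow> real \<Rightarrow> real" where
  "exit_time N f e \<theta> = \<theta> + queue N f e \<theta> / capacity N e + delay N e"

definition path_time :: "('v, 'e) fluid_network \<Rightarrow> 'e flow_over_time \<Rightarrow> 'e list \<Rightarrow> real \<Rightarrow> real" where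
  "path_time N f P \<theta> = fold (exit_time N f) P \<theta>"

text \<open>Paths are simple, hence finite in number; the only one from the source to itself is the
  empty path, which gives the earliest time \<open>\<theta>\<close> there.\<close>

definition earliest_time :: "('v, 'e) fluid_network \<Rightarrow> 'e flow_over_time \<Rightarrow> 'v \<Rightarrow> real \<Rightarrow> real" where
  "earliest_time N f w \<theta> =
     Min {path_time N f P \<theta> | P. pre_digraph.apath (graph_of N) (source N) P w}"

definition active_arcs :: "('v, 'e) fluid_network \<Rightarrow> 'e flow_over_time \<Rightarrow> real \<Rightarrow> 'e set" where
  "active_arcs N f \<theta> =
     {e \<in> arcs (graph_of N).
        exit_time N f e (earliest_time N f (tail (graph_of N) e) \<theta>)
          \<le> earliest_time N f (head (graph_of N) e) \<theta>}"

definition active_times :: "('v, 'e) fluid_network \<Rightarrow> 'e flow_over_time \<Rightarrow> 'e \<Rightarrow> real set" where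
  "active_times N f e = {\<theta>. e \<in> active_arcs N f \<theta>}"

definition resetting_arcs :: "('v, 'e) fluid_network \<Rightarrow> 'e flow_over_time \<Rightarrow> real \<Rightarrow> 'e set" where
  "resetting_arcs N f \<theta> =
     {e \<in> arcs (graph_of N). queue N f e (earliest_time N f (tail (graph_of N) e) \<theta>) > 0}"

definition dynamic_equilibrium ::
  "('v, 'e) fluid_network \<Rightarrow> (real \<Rightarrow> real) \<Rightarrow> 'e flow_over_time \<Rightarrow> bool" where
  "dynamic_equilibrium N u f \<longleftrightarrow>
     feasible N u f \<and>
     (\<forall>e\<in>arcs (graph_of N). AE \<xi> in lebesgue.
        \<xi> \<in> earliest_time N f (tail (graph_of N) e) ` (UNIV - active_times N f e) \<longrightarrow>
        fst f e \<xi> = 0)"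

definition cumulative_flow :: "('v, 'e) fluid_network \<Rightarrow> 'e flow_over_time \<Rightarrow> 'e \<Rightarrow> real \<Rightarrow> real" where
  "cumulative_flow N f e \<theta> =
     cumulative (fst f e) (earliest_time N f (tail (graph_of N) e) \<theta>)"


section \<open>Normalized thin flows with resetting\<close>

text \<open>Throughout, \<open>Es\<close> stands for $E^*$, \<open>E'\<close> for the set of active arcs, \<open>u0\<close> for the flow
  value, and \<open>y\<close>, \<open>l\<close> for the flow vector $x'$ and the labels $\ell'$.\<close>

definition resetting_configuration ::
  "('v, 'e) fluid_network \<Rightarrow> 'e set \<Rightarrow> 'e set \<Rightarrow> bool" where
  "resetting_configuration N Es E' \<longleftrightarrow>
     Es \<subseteq> E' \<and> E' \<subseteq> arcs (graph_of N) \<and>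
     (\<nexists>C. pre_digraph.cycle (graph_of N) C \<and> set C \<subseteq> E') \<and>
     (\<forall>v\<in>verts (graph_of N).
        \<exists>P. pre_digraph.apath (graph_of N) (source N) P v \<and> set P \<subseteq> E')"

definition static_flows :: "('v, 'e) fluid_network \<Rightarrow> 'e set \<Rightarrow> real \<Rightarrow> ('e \<Rightarrow> real) set" where
  "static_flows N E' u0 =
     {y. (\<forall>e\<in>arcs (graph_of N). y e \<ge> 0) \<and>
         (\<forall>e\<in>arcs (graph_of N) - E'. y e = 0) \<and>
         (\<forall>v\<in>verts (graph_of N).
            (\<Sum>e\<in>out_arcs (graph_of N) v. y e) - (\<Sum>e\<in>in_arcs (graph_of N) v. y e)
              = (if v = source N then u0 else if v = sink N then - u0 else 0))}"

definition arc_label ::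
  "('v, 'e) fluid_network \<Rightarrow> 'e set \<Rightarrow> 'e \<Rightarrow> real \<Rightarrow> real \<Rightarrow> real" where
  "arc_label N Es e a b = (if e \<in> Es then b / capacity N e else max a (b / capacity N e))"

text \<open>In a resetting configuration these equations determine \<open>l\<close> on all nodes, and the minimum
  ranges over a nonempty set.\<close>

definition corresponding_labels ::
  "('v, 'e) fluid_network \<Rightarrow> 'e set \<Rightarrow> 'e set \<Rightarrow> ('e \<Rightarrow> real) \<Rightarrow> ('v \<Rightarrow> real) \<Rightarrow> bool" where
  "corresponding_labels N Es E' y l \<longleftrightarrow>
     l (source N) = 1 \<and>
     (\<forall>w\<in>verts (graph_of N) - {source N}.
        l w = Min {arc_label N Es e (l (tail (graph_of N) e)) (y e) | e.
                     e \<in> E' \<and> head (graph_of N) e = w})"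

definition normalized_thin_flow ::
  "('v, 'e) fluid_network \<Rightarrow> real \<Rightarrow> 'e set \<Rightarrow> 'e set \<Rightarrow> ('e \<Rightarrow> real) \<Rightarrow> ('v \<Rightarrow> real) \<Rightarrow> bool" where
  "normalized_thin_flow N u0 Es E' y l \<longleftrightarrow>
     u0 \<ge> 0 \<and> resetting_configuration N Es E' \<and>
     y \<in> static_flows N E' u0 \<and> corresponding_labels N Es E' y l \<and>
     (\<forall>e\<in>E'. l (head (graph_of N) e) < arc_label N Es e (l (tail (graph_of N) e)) (y e) \<longrightarrow> y e = 0)"

end

theory Submission
  imports Defs
begin

text \<open>The key identity is $x_e(\theta) = F_e^+(\ell_v(\theta)) = F_e^-(\ell_w(\theta))$ for every arc $e = vw$: it holds
  at active times because queues are first-in-first-out, and between active times nothing enters $e$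
  along $\ell_v$. As $F_e^-$ is $\nu_e$-Lipschitz, it gives $x'_e/\nu_e \le \ell'_w$. The exit times
  $T_e(\ell_v)$ dominate $\ell_w$, with equality at active times; on $E^*$ they grow at rate
  $x'_e/\nu_e$, otherwise at rate at most $\max\{\ell'_v, x'_e/\nu_e\}$. The lower bound $\rho_e \le \ell'_w$ needs only that
  $e$ is active at times accumulating at $\theta$ from the right: since there are finitely many
  arcs, each $w \neq s$ has such an entering arc, and an arc that is not of this kind has $x'_e = 0$.\<close>

section \<open>Cumulative rates\<close>

lemma rate_functions_integrable:
  assumes "g \<in> rate_functions"
  shows "g integrable_on {a..b}"
  using assms set_lebesgue_integral_eq_integral(1) unfolding rate_functions_def by blast

lemma integral_AE_const:
  fixes g :: "real \<Rightarrow> real"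
  assumes "AE x in lebesgue. a < x \<and> x < b \<longrightarrow> g x = k" "a \<le> b"
  shows "integral {a..b} g = k * (b - a)"
proof -
  obtain S where S: "negligible S" "{x. \<not> (a < x \<and> x < b \<longrightarrow> g x = k)} \<subseteq> S"
    using assms(1) unfolding eventually_ae_filter_negligible by blast
  have "integral {a..b} g = integral {a..b} (\<lambda>_. k)"
  proof (rule integral_spike)
    show "negligible (S \<union> {a, b})"
      using S(1) by simp
  qed (use S(2) in force)
  then show ?thesis
    using assms(2) by (simp add: mult.commute)
qed

lemma integral_AE_le_const:
  fixes g :: "real \<Rightarrow> real"
  assumes "AE x in lebesgue. g x \<le> k" "g integrable_on {a..b}" "a \<le> b"
  shows "integral {a..b} g \<le> k * (b - a)"
proof -
  obtain S where S: "negligible S" "{x. \<not> g x \<le> k} \<subseteq> S"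
    using assms(1) unfolding eventually_ae_filter_negligible by blast
  have eq: "min (g x) k = g x" if "x \<in> {a..b} - S" for x
    using S(2) that by (auto simp: min_def)
  have int: "(\<lambda>x. min (g x) k) integrable_on {a..b}"
    by (rule integrable_spike[OF assms(2) S(1)]) (rule eq)
  have "integral {a..b} g = integral {a..b} (\<lambda>x. min (g x) k)"
    using eq by (intro integral_spike[OF S(1)]) auto
  also have "\<dots> \<le> integral {a..b} (\<lambda>_. k)"
    by (intro integral_le int) auto
  finally show ?thesis
    using assms(3) by (simp add: mult.commute)
qed

text \<open>The translate of a null set is null. Queue operation is specified for the outflow rate
  at times shifted by the delay; this removes the shift.\<close>

lemma AE_lebesgue_translate:
  fixes c :: real
  assumes "AE x in lebesgue. P (x + c)"
  shows "AE x in lebesgue. P x"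
proof -
  obtain S where S: "negligible S" "{x. \<not> P (x + c)} \<subseteq> S"
    using assms unfolding eventually_ae_filter_negligible by blast
  have "{x. \<not> P x} \<subseteq> (+) c ` S"
  proof
    fix x assume "x \<in> {x. \<not> P x}"
    then have "x - c \<in> S"
      using S(2) by auto
    then show "x \<in> (+) c ` S"
      by (intro image_eqI[of _ _ "x - c"]) auto
  qed
  then show ?thesis
    unfolding eventually_ae_filter_negligible using negligible_translation[OF S(1)] by blast
qed

lemma integral_rate_function_nonpos:
  assumes "g \<in> rate_functions" "b \<le> 0" "a \<le> b"
  shows "integral {a..b} g = 0"
proof -
  have "AE x in lebesgue. a < x \<and> x < b \<longrightarrow> g x = 0"
    using assms by (auto simp: rate_functions_def elim!: eventually_mono)
  then show ?thesis
    using integral_AE_const[of a b g 0] assms(3) by simp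
qed

text \<open>A rate vanishes a.e. on the negative axis, so the lower limit 0 may be moved to any
  \<open>c\<close> \<le> 0. With \<open>c\<close> also below \<open>x\<close>, the orientation of
  the integral no longer matters.\<close>

lemma cumulative_eq_integral:
  assumes g: "g \<in> rate_functions" and "c \<le> 0" "c \<le> x"
  shows "cumulative g x = integral {c..x} g"
proof -
  have ioo: "(LINT y:{a<..<b}|lebesgue. g y) = integral {a..b} g" for a b
  proof -
    have "set_integrable lebesgue {a..b} g"
      using g by (auto simp: rate_functions_def)
    then have "set_integrable lebesgue {a<..<b} g"
      by (rule set_integrable_subset) auto
    then show ?thesis
      by (simp add: set_lebesgue_integral_eq_integral integral_open_interval_real)
  qed
  show ?thesis
  proof (cases "0 \<le> x")
    case True
    then have "cumulative g x = integral {0..x} g"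
      unfolding cumulative_def using interval_lebesgue_integral_le_eq[of 0 "ereal x" lebesgue g]
      by (simp add: ioo[of 0 x, symmetric] zero_ereal_def)
    also have "\<dots> = integral {c..x} g"
      using Henstock_Kurzweil_Integration.integral_combine[of c 0 x g]
        integral_rate_function_nonpos[OF g, of 0 c] rate_functions_integrable[OF g] assms True
      by simp
    finally show ?thesis .
  next
    case False
    then have "cumulative g x = - integral {x..0} g"
      unfolding cumulative_def using interval_lebesgue_integral_gt_eq[of "ereal x" 0 lebesgue g]
      by (simp add: ioo[of x 0, symmetric] zero_ereal_def)
    then show ?thesis
      using False assms integral_rate_function_nonpos[OF g] by simp
  qed
qed

lemma cumulative_diff:
  assumes g: "g \<in> rate_functions" and "a \<le> b"
  shows "cumulative g b - cumulative g a = integral {a..b} g"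
proof -
  have "cumulative g x = integral {min a 0..x} g" if "a \<le> x" for x
    using that by (intro cumulative_eq_integral[OF g]) auto
  then show ?thesis
    using Henstock_Kurzweil_Integration.integral_combine[of "min a 0" a b g]
      rate_functions_integrable[OF g] assms(2) by (simp add: algebra_simps)
qed

lemma cumulative_nonpos:
  assumes "g \<in> rate_functions" "x \<le> 0"
  shows "cumulative g x = 0"
  using cumulative_eq_integral[of g x x] assms by simp

lemma cumulative_mono:
  assumes g: "g \<in> rate_functions" and "a \<le> b"
  shows "cumulative g a \<le> cumulative g b"
proof -
  have "0 \<le> integral {a..b} g"
    using g by (intro integral_nonneg rate_functions_integrable) (auto simp: rate_functions_def)
  then show ?thesis
    using cumulative_diff[OF assms] by simp
qed

lemma cumulative_diff_le:
  assumes g: "g \<in> rate_functions" and "AE x in lebesgue. g x \<le> k" "a \<le> b"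
  shows "cumulative g b - cumulative g a \<le> k * (b - a)"
  using integral_AE_le_const[OF assms(2) rate_functions_integrable[OF g] assms(3)]
    cumulative_diff[OF g assms(3)] by simp

lemma cumulative_diff_const:
  assumes g: "g \<in> rate_functions" and "AE x in lebesgue. a < x \<and> x < b \<longrightarrow> g x = k" "a \<le> b"
  shows "cumulative g b - cumulative g a = k * (b - a)"
  using integral_AE_const[OF assms(2,3)] cumulative_diff[OF g assms(3)] by simp

lemma isCont_cumulative:
  assumes g: "g \<in> rate_functions"
  shows "isCont (cumulative g) x"
proof -
  \<comment> \<open>Below both \<open>x\<close> and 0, so that one lower limit serves a whole
    neighbourhood of \<open>x\<close>.\<close>
  define c where "c = min x 0 - 1"
  have "continuous_on {c..x + 1} (\<lambda>y. integral {c..y} g)"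
    by (rule indefinite_integral_continuous_1[OF rate_functions_integrable[OF g]])
  then have "continuous_on {c..x + 1} (cumulative g)"
    by (rule continuous_on_eq) (auto simp: c_def intro!: cumulative_eq_integral[OF g, symmetric])
  then have "continuous_on {c<..<x + 1} (cumulative g)"
    by (rule continuous_on_subset) auto
  then show ?thesis
    by (subst (asm) continuous_on_eq_continuous_at) (auto simp: c_def)
qed

text \<open>Integrating the a.e. identity from one common lower limit \<le> 0 turns conservation of
  rates into conservation of cumulative flows at every time.\<close>

lemma cumulative_sum_eq:
  assumes fin: "finite A" "finite B"
    and A: "\<And>e. e \<in> A \<Longrightarrow> g e \<in> rate_functions" and B: "\<And>e. e \<in> B \<Longrightarrow> h e \<in> rate_functions"
    and k: "k \<in> rate_functions"
    and ae: "AE x in lebesgue. (\<Sum>e\<in>A. g e x) - (\<Sum>e\<in>B. h e x) = k x"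
  shows "(\<Sum>e\<in>A. cumulative (g e) y) - (\<Sum>e\<in>B. cumulative (h e) y) = cumulative k y"
proof -
  define c where "c = min y 0"
  have cum: "cumulative r y = integral {c..y} r" if "r \<in> rate_functions" for r
    by (rule cumulative_eq_integral[OF that]) (auto simp: c_def)
  obtain S where S: "negligible S" "{x. \<not> (\<Sum>e\<in>A. g e x) - (\<Sum>e\<in>B. h e x) = k x} \<subseteq> S"
    using ae unfolding eventually_ae_filter_negligible by blast
  have "(\<Sum>e\<in>A. cumulative (g e) y) - (\<Sum>e\<in>B. cumulative (h e) y)
      = integral {c..y} (\<lambda>x. (\<Sum>e\<in>A. g e x) - (\<Sum>e\<in>B. h e x))"
    using fin A B
    by (simp add: cum integral_sum Henstock_Kurzweil_Integration.integral_diff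
        rate_functions_integrable integrable_sum)
  also have "\<dots> = integral {c..y} k"
    by (rule integral_spike[OF S(1)]) (use S(2) in force)
  finally show ?thesis
    using cum[OF k] by simp
qed

section \<open>Right derivatives\<close>

text \<open>If \<open>D\<close> exceeded \<open>D'\<close>, the difference of the quotients would be
  positive on a right neighbourhood of \<open>a\<close>. Hence a comparison at points accumulating
  at \<open>a\<close> suffices, which is the form in which activity of an arc is available.\<close>

lemma right_derivative_le:
  fixes g h :: "real \<Rightarrow> real"
  assumes g: "(g has_real_derivative D) (at_right a)"
    and h: "(h has_real_derivative D') (at_right a)"
    and fr: "\<exists>\<^sub>F y in at_right a. g y - g a \<le> h y - h a"
  shows "D \<le> D'"
proof (rule ccontr)
  assume "\<not> D \<le> D'"
  moreover have "((\<lambda>y. (g y - g a) / (y - a) - (h y - h a) / (y - a)) \<longlongrightarrow> D - D') (at_right a)"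
    using g h by (intro tendsto_diff) (auto simp: has_field_derivative_iff)
  ultimately have "\<forall>\<^sub>F y in at_right a. (g y - g a) / (y - a) - (h y - h a) / (y - a) > 0"
    by (intro order_tendstoD(1)) auto
  moreover have "\<forall>\<^sub>F y in at_right a. a < y"
    by (rule eventually_at_right_less)
  ultimately have "\<forall>\<^sub>F y in at_right a. \<not> g y - g a \<le> h y - h a"
    by eventually_elim (auto simp: diff_divide_distrib[symmetric] zero_less_divide_iff)
  with fr show False
    by (simp add: frequently_def)
qed

lemma right_derivative_eq:
  fixes g h :: "real \<Rightarrow> real"
  assumes g: "(g has_real_derivative D) (at_right a)"
    and h: "(h has_real_derivative D') (at_right a)"
    and ev: "\<forall>\<^sub>F y in at_right a. g y - g a = h y - h a"
  shows "D = D'"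
proof -
  have fr: "\<exists>\<^sub>F y in at_right a. g y - g a = h y - h a"
    using ev by (rule eventually_frequently[rotated]) simp
  show ?thesis
  proof (rule antisym)
    show "D \<le> D'"
      by (rule right_derivative_le[OF g h]) (use fr in \<open>auto elim: frequently_elim1\<close>)
    show "D' \<le> D"
      by (rule right_derivative_le[OF h g]) (use fr in \<open>auto elim: frequently_elim1\<close>)
  qed
qed

lemma mono_right_derivative_nonneg:
  fixes g :: "real \<Rightarrow> real"
  assumes "\<And>y. a \<le> y \<Longrightarrow> g a \<le> g y" and g: "(g has_real_derivative D) (at_right a)"
  shows "0 \<le> D"
proof (rule right_derivative_le[OF DERIV_const[of 0] g])
  have "\<forall>\<^sub>F y in at_right a. 0 - 0 \<le> g y - g a"
    by (rule eventually_mono[OF eventually_at_right_less]) (simp add: assms(1))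
  then show "\<exists>\<^sub>F y in at_right a. 0 - 0 \<le> g y - g a"
    by (rule eventually_frequently[rotated]) simp
qed

text \<open>The bound is uniform over all \<open>x\<close> up to \<open>y\<close>, since it will be
  applied at an intermediate point that depends on \<open>y\<close> in an uncontrolled way.\<close>

lemma right_derivative_error:
  fixes g :: "real \<Rightarrow> real"
  assumes g: "(g has_real_derivative D) (at_right a)" and "0 < \<epsilon>"
  shows "\<forall>\<^sub>F y in at_right a. \<forall>x\<in>{a..y}. \<bar>g x - g a - D * (x - a)\<bar> \<le> \<epsilon> * (x - a)"
proof -
  have "((\<lambda>y. (g y - g a) / (y - a)) \<longlongrightarrow> D) (at_right a)"
    using g by (auto simp: has_field_derivative_iff)
  then have "\<forall>\<^sub>F y in at_right a. dist ((g y - g a) / (y - a)) D < \<epsilon>"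
    using \<open>0 < \<epsilon>\<close> by (rule tendstoD)
  then obtain b where b: "a < b"
    "\<And>y. a < y \<Longrightarrow> y < b \<Longrightarrow> dist ((g y - g a) / (y - a)) D < \<epsilon>"
    by (auto simp: eventually_at_right_field)
  have err: "\<bar>g x - g a - D * (x - a)\<bar> \<le> \<epsilon> * (x - a)" if "a \<le> x" "x < b" for x
  proof (cases "x = a")
    case False
    then have "a < x"
      using that by simp
    then have "g x - g a - D * (x - a) = ((g x - g a) / (x - a) - D) * (x - a)"
      by (simp add: field_simps)
    then have "\<bar>g x - g a - D * (x - a)\<bar> = \<bar>(g x - g a) / (x - a) - D\<bar> * (x - a)"
      using \<open>a < x\<close> by (simp add: abs_mult)
    also have "\<dots> \<le> \<epsilon> * (x - a)"
      using b(2)[of x] \<open>a < x\<close> that by (intro mult_right_mono) (auto simp: dist_real_def)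
    finally show ?thesis .
  qed simp
  show ?thesis
    unfolding eventually_at_right_field using b(1) err by (intro exI[of _ b]) auto
qed

section \<open>Queues\<close>

locale fluid_flow =
  fixes N :: "('v, 'e) fluid_network" and u :: "real \<Rightarrow> real" and f :: "'e flow_over_time"
  assumes valid: "valid_network N"
    and inflow_rate: "u \<in> rate_functions"
    and feas: "feasible N u f"
    and at_capacity: "queues_at_capacity N f"
begin

abbreviation G where "G \<equiv> graph_of N"
abbreviation s where "s \<equiv> source N"
abbreviation \<nu> where "\<nu> \<equiv> capacity N"
abbreviation \<tau> where "\<tau> \<equiv> delay N"
abbreviation inflow where "inflow e \<equiv> cumulative (fst f e)"
abbreviation outflow where "outflow e \<equiv> cumulative (snd f e)"
abbreviation z where "z \<equiv> queue N f"
abbreviation T where "T \<equiv> exit_time N f"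
abbreviation \<l> where "\<l> \<equiv> earliest_time N f"

sublocale digraph "graph_of N"
  using valid by (simp add: valid_network_def)

context
  fixes e assumes e: "e \<in> arcs G"
begin

lemma capacity_pos: "0 < \<nu> e" and delay_nonneg: "0 \<le> \<tau> e"
  using valid e by (auto simp: valid_network_def)

lemma rates: "fst f e \<in> rate_functions" "snd f e \<in> rate_functions"
  using feas e by (auto simp: feasible_def)

lemma outflow_Lipschitz:
  assumes "a \<le> b"
  shows "outflow e b - outflow e a \<le> \<nu> e * (b - a)"
proof -
  have "AE x in lebesgue. snd f e x \<le> \<nu> e"
    using feas e unfolding feasible_def by (auto elim: eventually_mono)
  then show ?thesis
    using rates(2) assms by (intro cumulative_diff_le)
qed

lemma isCont_queue: "isCont (z e) x"
proof -
  have "isCont (\<lambda>y. cumulative (snd f e) (y + \<tau> e)) x"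
    by (rule isCont_o2[OF _ isCont_cumulative[OF rates(2)]]) simp
  then show ?thesis
    unfolding queue_def by (intro continuous_intros isCont_cumulative[OF rates(1)])
qed

text \<open>Feasibility gives the bound almost everywhere only; as the queue is continuous, the set
  where it is negative is open and null, hence empty.\<close>

lemma queue_nonneg: "0 \<le> z e x"
proof (rule ccontr)
  assume "\<not> 0 \<le> z e x"
  then have "{y. z e y < 0} \<noteq> {}"
    by (auto simp: not_le)
  moreover have "open {y. z e y < 0}"
    by (intro open_Collect_less continuous_at_imp_continuous_on) (auto intro: isCont_queue)
  moreover have "AE y in lebesgue. 0 \<le> z e y"
    using feas e unfolding feasible_def by (auto elim: eventually_mono)
  then have "negligible {y. z e y < 0}"
    unfolding eventually_ae_filter_negligible by (auto simp: not_le intro: negligible_subset)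
  ultimately show False
    using open_not_negligible by blast
qed

lemma queue_nonpos:
  assumes "x \<le> 0"
  shows "z e x = 0"
proof -
  have "0 \<le> outflow e (x + \<tau> e)"
    using cumulative_mono[OF rates(2), of "min 0 (x + \<tau> e)" "x + \<tau> e"]
    by (simp add: cumulative_nonpos[OF rates(2)])
  then show ?thesis
    using queue_nonneg[of x] cumulative_nonpos[OF rates(1) assms] by (simp add: queue_def)
qed

lemma outflow_at_capacity:
  assumes "a \<le> b" "\<And>x. a < x \<Longrightarrow> x < b \<Longrightarrow> 0 < z e x"
  shows "outflow e (b + \<tau> e) - outflow e (a + \<tau> e) = \<nu> e * (b - a)"
proof -
  have "AE x in lebesgue. snd f e (x + \<tau> e) =
      (if 0 < z e x then \<nu> e else min (fst f e x) (\<nu> e))"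
    using at_capacity e by (auto simp: queues_at_capacity_def)
  then have "AE x in lebesgue. a + \<tau> e < x + \<tau> e \<and> x + \<tau> e < b + \<tau> e \<longrightarrow> snd f e (x + \<tau> e) = \<nu> e"
    by eventually_elim (use assms(2) in auto)
  then have "AE x in lebesgue. a + \<tau> e < x \<and> x < b + \<tau> e \<longrightarrow> snd f e x = \<nu> e"
    by (rule AE_lebesgue_translate)
  then show ?thesis
    using cumulative_diff_const[OF rates(2), of "a + \<tau> e" "b + \<tau> e" "\<nu> e"] assms(1) by simp
qed

text \<open>The increment of \<open>T e\<close> is \<open>b - a\<close>, minus outflow over
  capacity, plus inflow over capacity. While the queue is positive the first two cancel, since
  outflow runs at rate \<open>\<nu> e\<close>.\<close>

lemma exit_time_diff:
  assumes "a \<le> b" "\<And>x. a < x \<Longrightarrow> x < b \<Longrightarrow> 0 < z e x"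
  shows "T e b - T e a = (inflow e b - inflow e a) / \<nu> e"
proof -
  have "b - a = (outflow e (b + \<tau> e) - outflow e (a + \<tau> e)) / \<nu> e"
    using outflow_at_capacity[OF assms] capacity_pos by simp
  then show ?thesis
    by (simp add: exit_time_def queue_def diff_divide_distrib)
qed

lemma queue_decrease:
  assumes "a \<le> b"
  shows "z e a - z e b \<le> \<nu> e * (b - a)"
  using outflow_Lipschitz[of "a + \<tau> e" "b + \<tau> e"] cumulative_mono[OF rates(1) assms] assms
  by (simp add: queue_def)

text \<open>Entering later by \<open>b - a\<close> shortens the waiting time by at most
  \<open>b - a\<close>, because the queue drains no faster than \<open>\<nu> e\<close>.\<close>

lemma exit_time_mono:
  assumes "a \<le> b"
  shows "T e a \<le> T e b"
proof -
  have "(z e a - z e b) / \<nu> e \<le> b - a"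
    using queue_decrease[OF assms] capacity_pos by (simp add: divide_le_eq mult.commute)
  then show ?thesis
    by (simp add: exit_time_def diff_divide_distrib)
qed

lemma exit_time_ge: "x + \<tau> e \<le> T e x"
  using queue_nonneg[of x] capacity_pos by (simp add: exit_time_def)

lemma isCont_exit_time: "isCont (T e) x"
  using capacity_pos unfolding exit_time_def by (intro continuous_intros isCont_queue) auto

lemma queue_pos_until_exit:
  assumes "x \<le> y" "y < x + z e x / \<nu> e"
  shows "0 < z e y"
proof -
  have "\<nu> e * (y - x) < z e x"
    using assms(2) capacity_pos by (simp add: field_simps)
  then show ?thesis
    using queue_decrease[OF assms(1)] by simp
qed

text \<open>First-in-first-out: the queue met at \<open>x\<close> stays positive for its whole
  waiting time, so outflow then runs at capacity and discharges exactly
  \<open>z e x\<close>.\<close>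

lemma outflow_exit_time: "outflow e (T e x) = inflow e x"
proof -
  have "outflow e (x + z e x / \<nu> e + \<tau> e) - outflow e (x + \<tau> e) = \<nu> e * (x + z e x / \<nu> e - x)"
    using queue_nonneg[of x] capacity_pos queue_pos_until_exit[of x]
    by (intro outflow_at_capacity) auto
  then show ?thesis
    using capacity_pos by (simp add: exit_time_def queue_def)
qed

text \<open>Just before \<open>T e x\<close> outflow runs at capacity, so a positive amount is still
  missing. The strictness later forces arcs with a queue to be active.\<close>

lemma outflow_less_inflow:
  assumes "0 < z e x" "y < T e x"
  shows "outflow e y < inflow e x"
proof -
  define b where "b = x + z e x / \<nu> e"
  \<comment> \<open>The queue is known to be positive only from \<open>x\<close> on; an earlier
    \<open>y - \<tau> e\<close> is handled by monotonicity of the outflow.\<close>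
  define a where "a = max x (y - \<tau> e)"
  have "x < b" "T e x = b + \<tau> e"
    using assms(1) capacity_pos by (auto simp: b_def exit_time_def)
  then have "a < b"
    using assms(2) by (auto simp: a_def)
  then have "outflow e (b + \<tau> e) - outflow e (a + \<tau> e) = \<nu> e * (b - a)"
    using queue_pos_until_exit[of x] by (intro outflow_at_capacity) (auto simp: a_def b_def)
  moreover have "0 < \<nu> e * (b - a)"
    using \<open>a < b\<close> capacity_pos by simp
  moreover have "outflow e y \<le> outflow e (a + \<tau> e)"
    by (intro cumulative_mono rates) (auto simp: a_def)
  ultimately show ?thesis
    using outflow_exit_time[of x] \<open>T e x = b + \<tau> e\<close> by simp
qed

end

section \<open>Earliest times\<close>

lemma path_time_Nil [simp]: "path_time N f [] x = x"
  by (simp add: path_time_def)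

lemma path_time_snoc [simp]: "path_time N f (P @ [e]) x = T e (path_time N f P x)"
  by (simp add: path_time_def)

lemma path_time_append: "path_time N f (P @ Q) x = path_time N f Q (path_time N f P x)"
  by (simp add: path_time_def)

lemma path_time_mono:
  assumes "set P \<subseteq> arcs G" "x \<le> y"
  shows "path_time N f P x \<le> path_time N f P y"
  using assms by (induction P rule: rev_induct) (auto intro: exit_time_mono)

lemma path_time_ge:
  assumes "set P \<subseteq> arcs G"
  shows "x \<le> path_time N f P x"
  using assms
proof (induction P rule: rev_induct)
  case (snoc e P)
  then have "x \<le> path_time N f P x" "e \<in> arcs G"
    by auto
  then show ?case
    using exit_time_ge[of e "path_time N f P x"] delay_nonneg[of e] by simp
qed simp

lemma isCont_path_time:
  assumes "set P \<subseteq> arcs G"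
  shows "isCont (path_time N f P) x"
  using assms
proof (induction P rule: rev_induct)
  case Nil
  then show ?case
    by (simp add: path_time_def)
next
  case (snoc e P)
  then have "isCont (\<lambda>x. T e (path_time N f P x)) x"
    by (intro isCont_o2[OF _ isCont_exit_time]) auto
  then show ?case
    by simp
qed

text \<open>At nonpositive times queues are empty and \<open>T e\<close> is the shift by
  \<open>\<tau> e\<close>; monotonicity of \<open>T e\<close> carries this through the
  composition.\<close>

lemma path_time_unbounded_below:
  assumes "set P \<subseteq> arcs G"
  shows "\<exists>b. \<forall>x\<le>b. path_time N f P x \<le> c"
  using assms
proof (induction P arbitrary: c rule: rev_induct)
  case (snoc e P)
  define y where "y = min 0 (c - \<tau> e)"
  have e: "e \<in> arcs G"
    using snoc.prems by simp
  have "T e y \<le> c"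
    by (simp add: exit_time_def queue_nonpos[OF e] y_def)
  moreover obtain b where "\<forall>x\<le>b. path_time N f P x \<le> y"
    using snoc by force
  ultimately show ?case
    using exit_time_mono[OF e] by (metis order_trans path_time_snoc)
qed auto

lemma source_in_verts: "s \<in> verts G"
  using valid by (simp add: valid_network_def)

lemma finite_paths: "finite {P. apath s P w}"
  by (rule apaths_finite)

lemma paths_nonempty:
  assumes "w \<in> verts G"
  shows "{P. apath s P w} \<noteq> {}"
proof -
  have "s \<rightarrow>\<^sup>*\<^bsub>G\<^esub> w"
    using valid assms by (simp add: valid_network_def)
  then show ?thesis
    using reachable_apath by blast
qed

lemma earliest_time_eq_Min:
  "\<l> w x = Min ((\<lambda>P. path_time N f P x) ` {P. apath s P w})"
  unfolding earliest_time_def by (rule arg_cong[of _ _ Min]) auto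

lemma earliest_time_le_path:
  assumes "apath s P w"
  shows "\<l> w x \<le> path_time N f P x"
  unfolding earliest_time_eq_Min using assms by (intro Min_le finite_imageI finite_paths) auto

lemma earliest_time_attained:
  assumes "w \<in> verts G"
  obtains P where "apath s P w" "\<l> w x = path_time N f P x"
proof -
  have "\<l> w x \<in> (\<lambda>P. path_time N f P x) ` {P. apath s P w}"
    unfolding earliest_time_eq_Min
    using paths_nonempty[OF assms] by (intro Min_in finite_imageI finite_paths) auto
  then show thesis
    using that by auto
qed

lemma apath_arcs: "apath v P w \<Longrightarrow> set P \<subseteq> arcs G"
  by (auto simp: apath_def)

lemma earliest_time_source: "\<l> s x = x"
proof -
  have "P = []" if "apath s P s" for P
    using apath_nonempty_ends[OF that] by auto
  then show ?thesis
    using earliest_time_attained[OF source_in_verts, of x] by (metis path_time_Nil)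
qed

lemma earliest_time_mono:
  assumes "w \<in> verts G" "x \<le> y"
  shows "\<l> w x \<le> \<l> w y"
proof -
  obtain P where "apath s P w" "\<l> w y = path_time N f P y"
    using earliest_time_attained[OF assms(1)] .
  then show ?thesis
    using earliest_time_le_path[of P w x] path_time_mono[OF apath_arcs assms(2), of s P w] by simp
qed

lemma isCont_earliest_time:
  assumes "w \<in> verts G"
  shows "isCont (\<l> w) x"
proof -
  have "isCont (\<lambda>x. Min ((\<lambda>P. path_time N f P x) ` A)) x"
    if "finite A" "A \<noteq> {}" "\<And>P. P \<in> A \<Longrightarrow> set P \<subseteq> arcs G" for A
    using that
  proof (induction A rule: finite_ne_induct)
    case (singleton P)
    then show ?case
      by (simp add: isCont_path_time)
  next
    case (insert P A)
    then have "isCont (\<lambda>x. min (path_time N f P x) (Min ((\<lambda>P. path_time N f P x) ` A))) x"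
      by (intro continuous_min isCont_path_time) auto
    then show ?case
      using insert.hyps by simp
  qed
  from this[OF finite_paths paths_nonempty[OF assms]] show ?thesis
    unfolding earliest_time_eq_Min[abs_def] using apath_arcs by simp
qed

lemma earliest_time_unbounded_below:
  assumes "w \<in> verts G"
  obtains b where "\<l> w b \<le> c" "b \<le> a"
proof -
  obtain P where P: "apath s P w"
    using paths_nonempty[OF assms] by auto
  then obtain b where "\<forall>x\<le>b. path_time N f P x \<le> c"
    using path_time_unbounded_below[OF apath_arcs] by blast
  then have "\<l> w (min a b) \<le> c"
    using earliest_time_le_path[OF P, of "min a b"] by (meson min.cobounded2 order_trans)
  then show thesis
    using that[of "min a b"] by simp
qed

text \<open>Appending \<open>e\<close> to an optimal path to its tail works unless the head already
  lies on that path; then the prefix ending at the head is a simple path that arrives no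
  later.\<close>

lemma earliest_time_le_exit_time:
  assumes e: "e \<in> arcs G"
  shows "\<l> (head G e) x \<le> T e (\<l> (tail G e) x)"
proof -
  obtain P where P: "apath s P (tail G e)" "\<l> (tail G e) x = path_time N f P x"
    using earliest_time_attained[OF tail_in_verts[OF e]] .
  show ?thesis
  proof (cases "head G e \<in> set (awalk_verts s P)")
    case True
    then obtain Q R where QR: "P = Q @ R" "awalk s Q (head G e)"
      using awalk_decomp[OF awalkI_apath[OF P(1)]] by blast
    have Q: "apath s Q (head G e)"
      using P(1) QR by (auto simp: apath_append_iff)
    have arcs: "set P \<subseteq> arcs G" "set R \<subseteq> arcs G"
      using apath_arcs[OF P(1)] QR(1) by auto
    have "path_time N f Q x \<le> path_time N f P x"
      using path_time_ge[OF arcs(2)] by (simp add: QR(1) path_time_append)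
    also have "\<dots> \<le> T e (path_time N f P x)"
      using exit_time_ge[OF e, of "path_time N f P x"] delay_nonneg[OF e] by simp
    finally show ?thesis
      using earliest_time_le_path[OF Q, of x] P(2) by simp
  next
    case False
    then have "apath s (P @ [e]) (head G e)"
      using P(1) e by (auto simp: apath_append_iff apath_simps apath_def[of s P] awlast_of_awalk dest: no_loops)
    then show ?thesis
      using earliest_time_le_path[of "P @ [e]" "head G e" x] P(2) by simp
  qed
qed

section \<open>Active arcs and the subgraph they form\<close>

lemma active_arc_iff:
  "e \<in> active_arcs N f x \<longleftrightarrow> e \<in> arcs G \<and> T e (\<l> (tail G e) x) = \<l> (head G e) x"
  using earliest_time_le_exit_time[of e x] by (auto simp: active_arcs_def)

text \<open>The last arc of an optimal path is active: the rest of the path reaches the tail no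
  sooner than its earliest time, and \<open>T e\<close> is monotone.\<close>

lemma active_arc_exists:
  assumes "w \<in> verts G" "w \<noteq> s"
  obtains e where "e \<in> active_arcs N f x" "head G e = w"
proof -
  obtain P where P: "apath s P w" "\<l> w x = path_time N f P x"
    using earliest_time_attained[OF assms(1)] .
  have "P \<noteq> []"
    using P(1) assms(2) by (auto simp: apath_Nil_iff)
  then obtain Q e where Qe: "P = Q @ [e]"
    by (metis rev_exhaust)
  then have Q: "apath s Q (tail G e)" and e: "e \<in> arcs G" "head G e = w"
    using P(1) by (auto simp: apath_append_iff apath_simps)
  have "T e (\<l> (tail G e) x) \<le> \<l> w x"
    using exit_time_mono[OF e(1) earliest_time_le_path[OF Q, of x]] P(2) Qe by simp
  then show thesis
    using e by (intro that) (auto simp: active_arcs_def)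
qed

text \<open>Each active arc raises the earliest time by at least its delay, and the increments
  telescope. On a closed walk the total delay is thus at most 0, which rules out active
  cycles.\<close>

lemma earliest_time_add_delay:
  assumes "awalk v P w" "set P \<subseteq> active_arcs N f x"
  shows "\<l> v x + sum_list (map \<tau> P) \<le> \<l> w x"
  using assms
proof (induction P arbitrary: v)
  case Nil
  then show ?case
    by (auto simp: awalk_Nil_iff)
next
  case (Cons e P)
  then have "\<l> (head G e) x + sum_list (map \<tau> P) \<le> \<l> w x" and e: "e \<in> arcs G" "v = tail G e"
    by (auto simp: awalk_Cons_iff)
  moreover have "\<l> v x + \<tau> e \<le> \<l> (head G e) x"
    using exit_time_ge[OF e(1), of "\<l> v x"] Cons.prems e by (simp add: active_arcs_def)
  ultimately show ?case
    by simp
qed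

lemma active_arcs_acyclic:
  assumes "cycle C"
  shows "\<not> set C \<subseteq> active_arcs N f x"
proof
  assume C: "set C \<subseteq> active_arcs N f x"
  obtain v where "awalk v C v" "distinct C"
    using assms by (auto simp: cycle_conv)
  then have "sum \<tau> (set C) \<le> 0"
    using earliest_time_add_delay[OF _ C, of v v] by (simp add: sum_list_distinct_conv_sum_set)
  moreover have "0 < sum \<tau> (set C)"
    using valid assms by (simp add: valid_network_def)
  ultimately show False
    by simp
qed

text \<open>The arcs of an optimal path need not all be active, since \<open>T e\<close> may be
  constant on an interval. Instead active entering arcs are followed backwards from
  \<open>w\<close>; acyclicity and finiteness make this stop, and only at the source.\<close>

lemma active_path_exists:
  assumes "w \<in> verts G"
  shows "\<exists>P. apath s P w \<and> set P \<subseteq> active_arcs N f x"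
proof -
  \<comment> \<open>In this subgraph a closed walk yields a cycle consisting of active arcs.\<close>
  define H where "H = G\<lparr>arcs := active_arcs N f x\<rparr>"
  have sub: "active_arcs N f x \<subseteq> arcs G"
    by (auto simp: active_arcs_def)
  interpret H: fin_digraph H
    by unfold_locales (use sub finite_subset[OF sub finite_arcs] in \<open>auto simp: H_def\<close>)
  have HG: "subgraph H G"
    using sub by (auto simp: subgraph_def H_def compatible_def intro: H.wf_digraph[unfolded H_def] wf_digraph)
  have "acyclic (arcs_ends H)"
  proof (rule acyclicI, intro allI notI)
    fix v assume "(v, v) \<in> (arcs_ends H)\<^sup>+"
    then have "\<exists>P. H.closed_w P"
      by (auto simp: H.closed_w_def H.reachable1_awalk)
    then obtain C where C: "H.cycle C"
      using H.closed_w_imp_cycle by blast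
    then have "set C \<subseteq> arcs H"
      by (auto simp: H.cycle_def H.awalk_def)
    then have "set C \<subseteq> active_arcs N f x"
      by (simp add: H_def)
    then show False
      using active_arcs_acyclic subgraph_cycle[OF HG C] by blast
  qed
  moreover have "finite (arcs_ends H)"
    by (simp add: arcs_ends_def)
  ultimately have "wf (arcs_ends H)"
    by (intro finite_acyclic_wf)
  then have "\<exists>P. awalk s P w \<and> set P \<subseteq> active_arcs N f x"
    using assms
  proof (induction w rule: wf_induct_rule)
    case (less w)
    show ?case
    proof (cases "w = s")
      case True
      then show ?thesis
        using source_in_verts by (intro exI[of _ "[]"]) (auto simp: awalk_Nil_iff)
    next
      case False
      then obtain e where e: "e \<in> active_arcs N f x" "head G e = w"
        using active_arc_exists[OF less.prems] by blast
      then have "(tail G e, w) \<in> arcs_ends H"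
        by (force simp: arcs_ends_conv H_def)
      then obtain P where "awalk s P (tail G e)" "set P \<subseteq> active_arcs N f x"
        using less.IH tail_in_verts e(1) sub by blast
      then show ?thesis
        using e sub by (intro exI[of _ "P @ [e]"]) (auto intro!: awalk_appendI simp: awalk_simps)
    qed
  qed
  then show ?thesis
    using apath_awalk_to_apath awalk_to_apath_subset by (meson order_trans)
qed

end

section \<open>Dynamic equilibria\<close>

locale equilibrium_flow = fluid_flow +
  assumes equilibrium: "dynamic_equilibrium N u f"
begin

abbreviation x where "x \<equiv> cumulative_flow N f"

context
  fixes e assumes e: "e \<in> arcs G"
begin

text \<open>The equilibrium condition speaks of values of the tail's earliest-time function; by
  continuity each entry time strictly between two values is itself a value.\<close>

lemma earliest_time_IVT:
  assumes "a \<le> b" "\<l> (tail G e) a < \<xi>" "\<xi> < \<l> (tail G e) b"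
  obtains \<eta> where "a < \<eta>" "\<eta> < b" "\<xi> = \<l> (tail G e) \<eta>"
proof -
  have "\<exists>\<eta>. a \<le> \<eta> \<and> \<eta> \<le> b \<and> \<l> (tail G e) \<eta> = \<xi>"
    using assms e by (intro IVT) (auto intro: isCont_earliest_time)
  then show thesis
    using that assms(2,3) by (metis less_le)
qed

lemma cumulative_flow_mono:
  assumes "a \<le> b"
  shows "x e a \<le> x e b"
  unfolding cumulative_flow_def
  using e assms by (intro cumulative_mono rates earliest_time_mono) auto

lemma cumulative_flow_const:
  assumes "a \<le> b" "\<And>\<eta>. a < \<eta> \<Longrightarrow> \<eta> < b \<Longrightarrow> e \<notin> active_arcs N f \<eta>"
  shows "x e b = x e a"
proof -
  let ?l = "\<l> (tail G e)"
  have "AE \<xi> in lebesgue. \<xi> \<in> ?l ` (UNIV - active_times N f e) \<longrightarrow> fst f e \<xi> = 0"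
    using equilibrium e by (auto simp: dynamic_equilibrium_def)
  then have "AE \<xi> in lebesgue. ?l a < \<xi> \<and> \<xi> < ?l b \<longrightarrow> fst f e \<xi> = 0"
  proof eventually_elim
    case (elim \<xi>)
    show ?case
    proof
      assume "?l a < \<xi> \<and> \<xi> < ?l b"
      then obtain \<eta> where "a < \<eta>" "\<eta> < b" "\<xi> = ?l \<eta>"
        using earliest_time_IVT[OF assms(1)] by metis
      then show "fst f e \<xi> = 0"
        using elim assms(2)[of \<eta>] by (auto simp: active_times_def)
    qed
  qed
  then have "inflow e (?l b) - inflow e (?l a) = 0 * (?l b - ?l a)"
    using e assms(1) by (intro cumulative_diff_const rates earliest_time_mono) auto
  then show ?thesis
    by (simp add: cumulative_flow_def)
qed

lemma isCont_slack: "isCont (\<lambda>\<eta>. T e (\<l> (tail G e) \<eta>) - \<l> (head G e) \<eta>) y"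
  using e by (intro continuous_intros isCont_o2[OF _ isCont_exit_time] isCont_earliest_time) auto

text \<open>If \<open>e\<close> is inactive at \<open>\<theta>\<close>, then nothing has entered it along the tail's earliest times since
  the last active time \<open>a\<close> before \<open>\<theta>\<close>, at which the claim holds with equality.\<close>

lemma cumulative_flow_le_outflow: "x e \<theta> \<le> outflow e (\<l> (head G e) \<theta>)"
proof -
  define A where "A = {..\<theta>} \<inter> active_times N f e"
  have times: "active_times N f e = {\<eta>. T e (\<l> (tail G e) \<eta>) - \<l> (head G e) \<eta> \<le> 0}"
    using e by (auto simp: active_times_def active_arcs_def)
  have "closed A"
    unfolding A_def times
    by (intro closed_Int closed_Collect_le continuous_at_imp_continuous_on) (auto intro: isCont_slack)
  show ?thesis
  proof (cases "A = {}")
    case True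
    \<comment> \<open>With no active time up to \<theta>, going back to a \<open>b\<close> whose
      arrival time at the tail is at most 0 shows that nothing has entered.\<close>
    obtain b where b: "\<l> (tail G e) b \<le> 0" "b \<le> \<theta>"
      using earliest_time_unbounded_below[OF tail_in_verts[OF e]] .
    have "x e \<theta> = x e b"
      using b(2) True by (intro cumulative_flow_const) (auto simp: A_def active_times_def disjoint_iff)
    also have "\<dots> = 0"
      using b(1) by (simp add: cumulative_flow_def cumulative_nonpos[OF rates(1)[OF e]])
    also have "\<dots> \<le> outflow e (\<l> (head G e) \<theta>)"
      using cumulative_mono[OF rates(2)[OF e], of "min 0 (\<l> (head G e) \<theta>)" "\<l> (head G e) \<theta>"]
      by (simp add: cumulative_nonpos[OF rates(2)[OF e]])
    finally show ?thesis .
  next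
    case False
    define a where "a = Sup A"
    have bdd: "bdd_above A"
      by (auto simp: A_def)
    have "a \<in> A"
      unfolding a_def using closed_contains_Sup[OF False bdd \<open>closed A\<close>] .
    then have a: "a \<le> \<theta>" "e \<in> active_arcs N f a"
      by (auto simp: A_def active_times_def)
    have "x e \<theta> = x e a"
    proof (rule cumulative_flow_const[OF a(1)])
      fix \<eta> assume "a < \<eta>" "\<eta> < \<theta>"
      then have "\<eta> \<notin> A"
        using cSup_upper[OF _ bdd, of \<eta>] by (auto simp: a_def)
      then show "e \<notin> active_arcs N f \<eta>"
        using \<open>\<eta> < \<theta>\<close> by (auto simp: A_def active_times_def)
    qed
    also have "\<dots> = outflow e (\<l> (head G e) a)"
      using outflow_exit_time[OF e, of "\<l> (tail G e) a"] a(2)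
      by (simp add: cumulative_flow_def active_arc_iff)
    also have "\<dots> \<le> outflow e (\<l> (head G e) \<theta>)"
      using e a(1) by (intro cumulative_mono rates earliest_time_mono) auto
    finally show ?thesis .
  qed
qed

text \<open>The reverse inequality holds since the earliest time at the head is at most the exit
  time, where the outflow equals \<open>x e \<theta>\<close>.\<close>

lemma cumulative_flow_eq_outflow: "x e \<theta> = outflow e (\<l> (head G e) \<theta>)"
proof -
  have "outflow e (\<l> (head G e) \<theta>) \<le> outflow e (T e (\<l> (tail G e) \<theta>))"
    by (intro cumulative_mono rates earliest_time_le_exit_time e)
  also have "\<dots> = x e \<theta>"
    by (simp add: outflow_exit_time[OF e] cumulative_flow_def)
  finally show ?thesis
    using cumulative_flow_le_outflow[of \<theta>] by simp
qed

text \<open>Were the head reached strictly before the exit time, the nonempty queue would make the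
  outflow there strictly less than \<open>x e \<theta>\<close>.\<close>

lemma resetting_arc_active:
  assumes "0 < z e (\<l> (tail G e) \<theta>)"
  shows "T e (\<l> (tail G e) \<theta>) = \<l> (head G e) \<theta>"
  using outflow_less_inflow[OF e assms, of "\<l> (head G e) \<theta>"] cumulative_flow_le_outflow[of \<theta>]
    earliest_time_le_exit_time[OF e, of \<theta>] by (force simp: cumulative_flow_def)

lemma exit_time_earliest_time_diff:
  assumes "a \<le> b" "\<And>\<eta>. a < \<eta> \<Longrightarrow> \<eta> < b \<Longrightarrow> 0 < z e (\<l> (tail G e) \<eta>)"
  shows "T e (\<l> (tail G e) b) - T e (\<l> (tail G e) a) = (x e b - x e a) / \<nu> e"
  unfolding cumulative_flow_def
proof (rule exit_time_diff[OF e])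
  show "\<l> (tail G e) a \<le> \<l> (tail G e) b"
    using e assms(1) by (intro earliest_time_mono) auto
  show "0 < z e \<xi>" if "\<l> (tail G e) a < \<xi>" "\<xi> < \<l> (tail G e) b" for \<xi>
    using earliest_time_IVT[OF assms(1) that] assms(2) by metis
qed

lemma isCont_queue_earliest_time: "isCont (\<lambda>\<eta>. z e (\<l> (tail G e) \<eta>)) y"
  using e by (intro isCont_o2[OF _ isCont_queue] isCont_earliest_time) auto

end

lemma resetting_configuration_active: "resetting_configuration N (resetting_arcs N f \<theta>) (active_arcs N f \<theta>)"
  unfolding resetting_configuration_def
proof (intro conjI ballI)
  show "resetting_arcs N f \<theta> \<subseteq> active_arcs N f \<theta>"
    using resetting_arc_active by (auto simp: resetting_arcs_def active_arc_iff)
  show "active_arcs N f \<theta> \<subseteq> arcs G"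
    by (auto simp: active_arcs_def)
  show "\<nexists>C. cycle C \<and> set C \<subseteq> active_arcs N f \<theta>"
    using active_arcs_acyclic by blast
  show "\<exists>P. apath s P v \<and> set P \<subseteq> active_arcs N f \<theta>" if "v \<in> verts G" for v
    using active_path_exists[OF that] .
qed

text \<open>Outgoing arcs contribute their inflow and, by \<open>cumulative_flow_eq_outflow\<close>,
  incoming arcs their outflow, all at the same time \<open>\<l> v \<theta>\<close>; so integrated
  conservation at \<open>v\<close> applies. At the source this time is \<theta> itself.\<close>

lemma cumulative_flow_conservation:
  assumes v: "v \<in> verts G" "v \<noteq> sink N"
  shows "(\<Sum>e\<in>out_arcs G v. x e \<theta>) - (\<Sum>e\<in>in_arcs G v. x e \<theta>)
    = (if v = s then cumulative u \<theta> else 0)"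
proof -
  have zero: "(\<lambda>_. 0) \<in> rate_functions"
    by (simp add: rate_functions_def set_integrable_def)
  define k where "k = (if v = s then u else (\<lambda>_. 0))"
  have "(\<Sum>e\<in>out_arcs G v. x e \<theta>) - (\<Sum>e\<in>in_arcs G v. x e \<theta>)
    = (\<Sum>e\<in>out_arcs G v. inflow e (\<l> v \<theta>)) - (\<Sum>e\<in>in_arcs G v. outflow e (\<l> v \<theta>))"
  proof (intro arg_cong2[of _ _ _ _ "(-)"] sum.cong refl)
    show "x e \<theta> = inflow e (\<l> v \<theta>)" if "e \<in> out_arcs G v" for e
      using that by (simp add: cumulative_flow_def)
    show "x e \<theta> = outflow e (\<l> v \<theta>)" if "e \<in> in_arcs G v" for e
      using that by (auto simp: cumulative_flow_eq_outflow)
  qed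
  also have "\<dots> = cumulative k (\<l> v \<theta>)"
  proof (rule cumulative_sum_eq)
    show "AE y in lebesgue. (\<Sum>e\<in>out_arcs G v. fst f e y) - (\<Sum>e\<in>in_arcs G v. snd f e y) = k y"
    proof -
      have "AE y in lebesgue. \<forall>v\<in>verts G - {sink N}.
          (\<Sum>e\<in>out_arcs G v. fst f e y) - (\<Sum>e\<in>in_arcs G v. snd f e y) = (if v = s then u y else 0)"
        using feas by (auto simp: feasible_def)
      then show ?thesis
        by eventually_elim (use v in \<open>auto simp: k_def\<close>)
    qed
  qed (auto simp: k_def inflow_rate zero intro: rates)
  also have "\<dots> = (if v = s then cumulative u \<theta> else 0)"
    by (simp add: k_def earliest_time_source) (simp add: cumulative_def interval_lebesgue_integral_def set_lebesgue_integral_def)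
  finally show ?thesis .
qed

section \<open>Right derivatives of the earliest times\<close>

text \<open>The gap between exit time and earliest time at the head is continuous, so a positive gap
  at \<theta> would persist to the right.\<close>

lemma frequently_active_imp_active:
  assumes "\<exists>\<^sub>F \<eta> in at_right \<theta>. e \<in> active_arcs N f \<eta>"
  shows "e \<in> active_arcs N f \<theta>"
proof (rule ccontr)
  assume not: "e \<notin> active_arcs N f \<theta>"
  have e: "e \<in> arcs G"
    using frequently_ex[OF assms] by (auto simp: active_arcs_def)
  have "((\<lambda>\<eta>. T e (\<l> (tail G e) \<eta>) - \<l> (head G e) \<eta>)
      \<longlongrightarrow> T e (\<l> (tail G e) \<theta>) - \<l> (head G e) \<theta>) (at_right \<theta>)"
    using isCont_slack[OF e] unfolding isCont_def by (rule filterlim_mono) (auto intro: at_le)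
  then have "\<forall>\<^sub>F \<eta> in at_right \<theta>. 0 < T e (\<l> (tail G e) \<eta>) - \<l> (head G e) \<eta>"
    using not e by (intro order_tendstoD(1)) (auto simp: active_arcs_def)
  then have "\<forall>\<^sub>F \<eta> in at_right \<theta>. e \<notin> active_arcs N f \<eta>"
    by eventually_elim (auto simp: active_arcs_def)
  then show False
    using assms by (simp add: frequently_def)
qed

text \<open>Otherwise the finitely many entering arcs would all be inactive at a common time,
  although some entering arc is active at every time.\<close>

lemma frequently_active_arc_exists:
  assumes "w \<in> verts G" "w \<noteq> s"
  shows "\<exists>e\<in>arcs G. head G e = w \<and> (\<exists>\<^sub>F \<eta> in at_right \<theta>. e \<in> active_arcs N f \<eta>)"
proof (rule ccontr)
  assume "\<not> ?thesis"
  then have "\<forall>e\<in>in_arcs G w. \<forall>\<^sub>F \<eta> in at_right \<theta>. e \<notin> active_arcs N f \<eta>"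
    by (auto simp: frequently_def)
  then have "\<forall>\<^sub>F \<eta> in at_right \<theta>. \<forall>e\<in>in_arcs G w. e \<notin> active_arcs N f \<eta>"
    by (intro eventually_ball_finite) auto
  then obtain \<eta> where "\<forall>e\<in>in_arcs G w. e \<notin> active_arcs N f \<eta>"
    using eventually_happens' trivial_limit_at_right_real by blast
  moreover obtain e where "e \<in> active_arcs N f \<eta>" "head G e = w"
    using active_arc_exists[OF assms] .
  ultimately show False
    by (auto simp: active_arc_iff)
qed

lemma eventually_inactive_imp_derivative_0:
  assumes e: "e \<in> arcs G" and x': "(x e has_real_derivative x') (at_right \<theta>)"
    and ev: "\<forall>\<^sub>F \<eta> in at_right \<theta>. e \<notin> active_arcs N f \<eta>"
  shows "x' = 0"
proof -
  obtain b where b: "\<theta> < b" "\<And>\<eta>. \<theta> < \<eta> \<Longrightarrow> \<eta> < b \<Longrightarrow> e \<notin> active_arcs N f \<eta>"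
    using ev by (auto simp: eventually_at_right_field)
  have "\<forall>\<^sub>F \<eta> in at_right \<theta>. x e \<eta> - x e \<theta> = 0 - 0"
    unfolding eventually_at_right_field
    by (rule exI[of _ b]) (use b cumulative_flow_const[OF e] in auto)
  then show ?thesis
    by (rule right_derivative_eq[OF x' DERIV_const])
qed

text \<open>By continuity the queue stays positive just after \<theta>. There \<open>e\<close>
  remains active, so the head's earliest time is the exit time, whose increments are those of the
  cumulative flow divided by capacity.\<close>

lemma resetting_derivative:
  assumes e: "e \<in> resetting_arcs N f \<theta>"
    and x': "(x e has_real_derivative x') (at_right \<theta>)"
    and w': "(\<l> (head G e) has_real_derivative w') (at_right \<theta>)"
  shows "w' = x' / \<nu> e"
proof -
  have arc: "e \<in> arcs G" and pos: "0 < z e (\<l> (tail G e) \<theta>)"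
    using e by (auto simp: resetting_arcs_def)
  have "((\<lambda>\<eta>. z e (\<l> (tail G e) \<eta>)) \<longlongrightarrow> z e (\<l> (tail G e) \<theta>)) (at_right \<theta>)"
    using isCont_queue_earliest_time[OF arc] unfolding isCont_def
    by (rule filterlim_mono) (auto intro: at_le)
  then have "\<forall>\<^sub>F \<eta> in at_right \<theta>. 0 < z e (\<l> (tail G e) \<eta>)"
    using pos by (rule order_tendstoD(1))
  then obtain b where b: "\<theta> < b" "\<And>\<eta>. \<theta> < \<eta> \<Longrightarrow> \<eta> < b \<Longrightarrow> 0 < z e (\<l> (tail G e) \<eta>)"
    by (auto simp: eventually_at_right_field)
  have "\<l> (head G e) \<eta> - \<l> (head G e) \<theta> = (x e \<eta> - x e \<theta>) / \<nu> e" if "\<theta> < \<eta>" "\<eta> < b" for \<eta>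
    using exit_time_earliest_time_diff[OF arc, of \<theta> \<eta>] resetting_arc_active[OF arc] pos b(2) that
    by simp
  then have "\<forall>\<^sub>F \<eta> in at_right \<theta>. \<l> (head G e) \<eta> - \<l> (head G e) \<theta> = x e \<eta> / \<nu> e - x e \<theta> / \<nu> e"
    unfolding eventually_at_right_field using b(1) by (auto simp: diff_divide_distrib)
  then show ?thesis
    by (rule right_derivative_eq[OF w' DERIV_cdivide[OF x']])
qed

text \<open>Along the head's earliest times the outflow is \<open>x e\<close>, and it grows at rate
  at most \<open>\<nu> e\<close> in those times.\<close>

lemma derivative_div_capacity_le:
  assumes e: "e \<in> arcs G"
    and x': "(x e has_real_derivative x') (at_right \<theta>)"
    and w': "(\<l> (head G e) has_real_derivative w') (at_right \<theta>)"
  shows "x' / \<nu> e \<le> w'"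
proof (rule right_derivative_le[OF DERIV_cdivide[OF x', of "\<nu> e"] w'])
  have "x e \<eta> / \<nu> e - x e \<theta> / \<nu> e \<le> \<l> (head G e) \<eta> - \<l> (head G e) \<theta>" if "\<theta> < \<eta>" for \<eta>
  proof -
    have "\<l> (head G e) \<theta> \<le> \<l> (head G e) \<eta>"
      using e that by (intro earliest_time_mono) auto
    then have "x e \<eta> - x e \<theta> \<le> \<nu> e * (\<l> (head G e) \<eta> - \<l> (head G e) \<theta>)"
      using outflow_Lipschitz[OF e] by (simp add: cumulative_flow_eq_outflow[OF e])
    then show ?thesis
      using capacity_pos[OF e] by (simp add: diff_divide_distrib[symmetric] divide_le_eq mult.commute)
  qed
  then have "\<forall>\<^sub>F \<eta> in at_right \<theta>. x e \<eta> / \<nu> e - x e \<theta> / \<nu> e \<le> \<l> (head G e) \<eta> - \<l> (head G e) \<theta>"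
    using eventually_at_right_less[of \<theta>] by (auto elim: eventually_mono)
  then show "\<exists>\<^sub>F \<eta> in at_right \<theta>. x e \<eta> / \<nu> e - x e \<theta> / \<nu> e \<le> \<l> (head G e) \<eta> - \<l> (head G e) \<theta>"
    by (rule eventually_frequently[rotated]) simp
qed

lemma frequently_active_derivative_le:
  assumes e: "e \<in> arcs G" and empty: "z e (\<l> (tail G e) \<theta>) = 0"
    and fr: "\<exists>\<^sub>F \<eta> in at_right \<theta>. e \<in> active_arcs N f \<eta>"
    and v': "(\<l> (tail G e) has_real_derivative v') (at_right \<theta>)"
    and w': "(\<l> (head G e) has_real_derivative w') (at_right \<theta>)"
  shows "v' \<le> w'"
proof (rule right_derivative_le[OF v' w'])
  \<comment> \<open>At \<theta> the queue is empty, so crossing \<open>e\<close> takes exactly the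
    delay; at later active times it takes at least the delay.\<close>
  have \<theta>: "\<l> (head G e) \<theta> = \<l> (tail G e) \<theta> + \<tau> e"
    using frequently_active_imp_active[OF fr] empty by (simp add: active_arc_iff exit_time_def)
  show "\<exists>\<^sub>F \<eta> in at_right \<theta>. \<l> (tail G e) \<eta> - \<l> (tail G e) \<theta> \<le> \<l> (head G e) \<eta> - \<l> (head G e) \<theta>"
    using fr
  proof (rule frequently_elim1)
    fix \<eta> assume "e \<in> active_arcs N f \<eta>"
    then show "\<l> (tail G e) \<eta> - \<l> (tail G e) \<theta> \<le> \<l> (head G e) \<eta> - \<l> (head G e) \<theta>"
      using exit_time_ge[OF e, of "\<l> (tail G e) \<eta>"] \<theta> by (simp add: active_arc_iff)
  qed
qed

text \<open>The capacity term is bounded on every arc; the tail term occurs only off the resetting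
  arcs, where the queue is empty at \<theta> and recurrent activity bounds it.\<close>

lemma arc_label_le:
  assumes e: "e \<in> arcs G"
    and fr: "\<exists>\<^sub>F \<eta> in at_right \<theta>. e \<in> active_arcs N f \<eta>"
    and v': "(\<l> (tail G e) has_real_derivative v') (at_right \<theta>)"
    and w': "(\<l> (head G e) has_real_derivative w') (at_right \<theta>)"
    and x': "(x e has_real_derivative x') (at_right \<theta>)"
  shows "arc_label N (resetting_arcs N f \<theta>) e v' x' \<le> w'"
proof -
  have "v' \<le> w'" if "e \<notin> resetting_arcs N f \<theta>"
    using frequently_active_derivative_le[OF e _ fr v' w'] queue_nonneg[OF e, of "\<l> (tail G e) \<theta>"] that e
    by (auto simp: resetting_arcs_def)
  then show ?thesis
    using derivative_div_capacity_le[OF e x' w'] by (auto simp: arc_label_def)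
qed

text \<open>Between \<open>\<theta>\<close> and \<open>y\<close>, let \<open>c\<close> be the last time at which the queue met by the particles is
  empty. The exit time grows like the arrival time at the tail up to \<open>c\<close> and at the rate at which
  capacity serves the inflow after \<open>c\<close>, so its average growth is a convex combination
  of the two terms of the maximum.\<close>

lemma exit_time_growth:
  assumes e: "e \<in> arcs G" and empty: "z e (\<l> (tail G e) \<theta>) = 0" and "\<theta> \<le> y"
  obtains c where "\<theta> \<le> c" "c \<le> y"
    "T e (\<l> (tail G e) y) - T e (\<l> (tail G e) \<theta>)
      = (\<l> (tail G e) c - \<l> (tail G e) \<theta>) + (x e y - x e c) / \<nu> e"
proof -
  define A where "A = {\<theta>..y} \<inter> {\<eta>. z e (\<l> (tail G e) \<eta>) = 0}"
  have "closed A"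
    unfolding A_def
    by (intro closed_Int closed_Collect_eq continuous_at_imp_continuous_on)
      (auto intro: isCont_queue_earliest_time[OF e])
  have bdd: "bdd_above A" and "A \<noteq> {}"
    using empty \<open>\<theta> \<le> y\<close> by (auto simp: A_def)
  define c where "c = Sup A"
  have "c \<in> A"
    unfolding c_def using closed_contains_Sup[OF \<open>A \<noteq> {}\<close> bdd \<open>closed A\<close>] .
  then have c: "\<theta> \<le> c" "c \<le> y" "z e (\<l> (tail G e) c) = 0"
    by (auto simp: A_def)
  have "0 < z e (\<l> (tail G e) \<eta>)" if "c < \<eta>" "\<eta> < y" for \<eta>
  proof -
    have "\<eta> \<notin> A"
      using cSup_upper[OF _ bdd, of \<eta>] that(1) by (auto simp: c_def)
    then show ?thesis
      using queue_nonneg[OF e, of "\<l> (tail G e) \<eta>"] that c(1) by (auto simp: A_def less_le)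
  qed
  then have "T e (\<l> (tail G e) y) - T e (\<l> (tail G e) c) = (x e y - x e c) / \<nu> e"
    using c(2) by (intro exit_time_earliest_time_diff[OF e]) auto
  then show thesis
    using c empty by (intro that[of c]) (auto simp: exit_time_def)
qed

text \<open>On a resetting arc equality holds. Otherwise the head's earliest time is bounded by the
  exit time, whose growth splits at the last empty-queue time \<open>c\<close> into two parts, each
  of slope at most \<open>M\<close> up to small errors.\<close>

lemma le_arc_label:
  assumes active: "e \<in> active_arcs N f \<theta>"
    and v': "(\<l> (tail G e) has_real_derivative v') (at_right \<theta>)"
    and w': "(\<l> (head G e) has_real_derivative w') (at_right \<theta>)"
    and x': "(x e has_real_derivative x') (at_right \<theta>)"
  shows "w' \<le> arc_label N (resetting_arcs N f \<theta>) e v' x'"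
proof (cases "e \<in> resetting_arcs N f \<theta>")
  case True
  then show ?thesis
    using resetting_derivative[OF True x' w'] by (simp add: arc_label_def)
next
  case False
  have e: "e \<in> arcs G"
    using active by (simp add: active_arc_iff)
  have empty: "z e (\<l> (tail G e) \<theta>) = 0"
    using False e queue_nonneg[OF e, of "\<l> (tail G e) \<theta>"] by (auto simp: resetting_arcs_def)
  note \<nu> = capacity_pos[OF e]
  define M where "M = max v' (x' / \<nu> e)"
  have M: "v' \<le> M" "x' / \<nu> e \<le> M"
    by (auto simp: M_def)
  \<comment> \<open>The factor collects one error from the tail's earliest time at \<open>c\<close>
    and two from the cumulative flow, at \<open>c\<close> and \<open>y\<close>, the latter divided
    by capacity; all are bounded in terms of \<open>y - \<theta>\<close>.\<close>
  have le: "w' \<le> M + \<epsilon> * (1 + 2 / \<nu> e)" if "0 < \<epsilon>" for \<epsilon>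
  proof -
    have lin: "((\<lambda>\<eta>. (M + \<epsilon> * (1 + 2 / \<nu> e)) * \<eta>) has_real_derivative M + \<epsilon> * (1 + 2 / \<nu> e)) (at_right \<theta>)"
      by (auto intro!: derivative_eq_intros)
    have "\<forall>\<^sub>F y in at_right \<theta>. \<l> (head G e) y - \<l> (head G e) \<theta>
        \<le> (M + \<epsilon> * (1 + 2 / \<nu> e)) * y - (M + \<epsilon> * (1 + 2 / \<nu> e)) * \<theta>"
      using right_derivative_error[OF v' that] right_derivative_error[OF x' that]
        eventually_at_right_less[of \<theta>]
    proof eventually_elim
      case (elim y)
      obtain c where c: "\<theta> \<le> c" "c \<le> y"
        "T e (\<l> (tail G e) y) - T e (\<l> (tail G e) \<theta>)
          = (\<l> (tail G e) c - \<l> (tail G e) \<theta>) + (x e y - x e c) / \<nu> e"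
        using exit_time_growth[OF e empty, of y] elim(3) by auto
      have "\<bar>\<l> (tail G e) c - \<l> (tail G e) \<theta> - v' * (c - \<theta>)\<bar> \<le> \<epsilon> * (c - \<theta>)"
        using elim(1) c by auto
      moreover have "v' * (c - \<theta>) \<le> M * (c - \<theta>)"
        using M(1) c(1) by (intro mult_right_mono) auto
      moreover have "\<epsilon> * (c - \<theta>) \<le> \<epsilon> * (y - \<theta>)"
        using that c(2) by (intro mult_left_mono) auto
      ultimately have 1: "\<l> (tail G e) c - \<l> (tail G e) \<theta> \<le> M * (c - \<theta>) + \<epsilon> * (y - \<theta>)"
        by linarith
      have "\<bar>x e c - x e \<theta> - x' * (c - \<theta>)\<bar> \<le> \<epsilon> * (c - \<theta>)"
        "\<bar>x e y - x e \<theta> - x' * (y - \<theta>)\<bar> \<le> \<epsilon> * (y - \<theta>)"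
        using elim(2,3) c by auto
      then have "x e y - x e c \<le> x' * (y - \<theta>) - x' * (c - \<theta>) + 2 * (\<epsilon> * (y - \<theta>))"
        using \<open>\<epsilon> * (c - \<theta>) \<le> \<epsilon> * (y - \<theta>)\<close> by linarith
      then have "(x e y - x e c) / \<nu> e \<le> (x' * (y - c) + 2 * (\<epsilon> * (y - \<theta>))) / \<nu> e"
        using \<nu> by (intro divide_right_mono) (auto simp: algebra_simps)
      also have "\<dots> = x' / \<nu> e * (y - c) + 2 / \<nu> e * (\<epsilon> * (y - \<theta>))"
        by (simp add: add_divide_distrib)
      also have "\<dots> \<le> M * (y - c) + 2 / \<nu> e * (\<epsilon> * (y - \<theta>))"
        using M(2) c(2) by (intro add_right_mono mult_right_mono) auto
      finally have 2: "(x e y - x e c) / \<nu> e \<le> M * (y - c) + 2 / \<nu> e * (\<epsilon> * (y - \<theta>))" .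
      have "\<l> (head G e) y - \<l> (head G e) \<theta> \<le> T e (\<l> (tail G e) y) - T e (\<l> (tail G e) \<theta>)"
        using earliest_time_le_exit_time[OF e, of y] active by (simp add: active_arc_iff)
      also have "\<dots> \<le> M * (c - \<theta>) + \<epsilon> * (y - \<theta>) + (M * (y - c) + 2 / \<nu> e * (\<epsilon> * (y - \<theta>)))"
        unfolding c(3) using 1 2 by (rule add_mono)
      also have "\<dots> = (M + \<epsilon> * (1 + 2 / \<nu> e)) * y - (M + \<epsilon> * (1 + 2 / \<nu> e)) * \<theta>"
        by (simp add: algebra_simps add_divide_distrib diff_divide_distrib)
      finally show ?case .
    qed
    then show ?thesis
      by (intro right_derivative_le[OF w' lin]) (rule eventually_frequently[rotated], auto)
  qed
  have "w' \<le> M"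
  proof (rule field_le_epsilon)
    fix d :: real assume "0 < d"
    moreover have k: "0 < 1 + 2 / \<nu> e"
      using \<nu> by (intro add_pos_pos) auto
    ultimately show "w' \<le> M + d"
      using le[of "d / (1 + 2 / \<nu> e)"] by simp
  qed
  then show ?thesis
    using False by (simp add: arc_label_def M_def)
qed

end

text \<open>Each arc is counted once positively at its tail and once negatively at its head.\<close>

lemma (in fin_digraph) sum_net_outflow:
  fixes y :: "'b \<Rightarrow> real"
  shows "(\<Sum>v\<in>verts G. (\<Sum>e\<in>out_arcs G v. y e) - (\<Sum>e\<in>in_arcs G v. y e)) = 0"
proof -
  have "(\<Sum>v\<in>verts G. \<Sum>e\<in>out_arcs G v. y e) = sum y (arcs G)"
    unfolding out_arcs_def by (rule sum.group) auto
  moreover have "(\<Sum>v\<in>verts G. \<Sum>e\<in>in_arcs G v. y e) = sum y (arcs G)"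
    unfolding in_arcs_def by (rule sum.group) auto
  ultimately show ?thesis
    by (simp add: sum_subtractf)
qed

section \<open>The thin flow conditions\<close>

context equilibrium_flow
begin

lemma static_flow_right_derivative:
  assumes u': "(cumulative u has_real_derivative u0) (at_right \<theta>)"
    and x': "\<And>e. e \<in> arcs G \<Longrightarrow> (x e has_real_derivative x' e) (at_right \<theta>)"
  shows "x' \<in> static_flows N (active_arcs N f \<theta>) u0"
proof -
  define net where "net v = (\<Sum>e\<in>out_arcs G v. x' e) - (\<Sum>e\<in>in_arcs G v. x' e)" for v
  have nonneg: "0 \<le> x' e" if "e \<in> arcs G" for e
    by (rule mono_right_derivative_nonneg[OF _ x'[OF that]]) (rule cumulative_flow_mono[OF that])
  have inactive: "x' e = 0" if "e \<in> arcs G - active_arcs N f \<theta>" for e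
    using that frequently_active_imp_active[of e \<theta>]
    by (intro eventually_inactive_imp_derivative_0[OF _ x']) (auto simp: frequently_def)
  have net: "net v = (if v = s then u0 else 0)" if v: "v \<in> verts G" "v \<noteq> sink N" for v
  proof (rule right_derivative_eq)
    show "((\<lambda>\<theta>. (\<Sum>e\<in>out_arcs G v. x e \<theta>) - (\<Sum>e\<in>in_arcs G v. x e \<theta>))
        has_real_derivative net v) (at_right \<theta>)"
      unfolding net_def by (intro DERIV_diff DERIV_sum x') auto
    show "((\<lambda>\<theta>. if v = s then cumulative u \<theta> else 0)
        has_real_derivative (if v = s then u0 else 0)) (at_right \<theta>)"
      using u' by simp
  qed (simp add: cumulative_flow_conservation[OF v])
  have "sink N \<in> verts G" "sink N \<noteq> s"
    using valid by (auto simp: valid_network_def)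
  \<comment> \<open>Feasibility prescribes no balance at the sink; it follows from the other nodes,
    as all net outflows sum to zero.\<close>
  have "0 = net (sink N) + (\<Sum>v\<in>verts G - {sink N}. net v)"
    using sum_net_outflow[of x'] sum.remove[OF finite_verts \<open>sink N \<in> verts G\<close>, of net]
    by (simp add: net_def)
  also have "(\<Sum>v\<in>verts G - {sink N}. net v) = (\<Sum>v\<in>verts G - {sink N}. if v = s then u0 else 0)"
    by (intro sum.cong) (auto simp: net)
  also have "\<dots> = u0"
    using source_in_verts \<open>sink N \<noteq> s\<close> by simp
  finally have "net (sink N) = - u0"
    by simp
  then show ?thesis
    using nonneg inactive net \<open>sink N \<noteq> s\<close> by (auto simp: static_flows_def net_def)
qed

lemma normalized_thin_flow_right_derivative:
  assumes u': "(cumulative u has_real_derivative u0) (at_right \<theta>)"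
    and l': "\<And>v. v \<in> verts G \<Longrightarrow> (\<l> v has_real_derivative l' v) (at_right \<theta>)"
    and x': "\<And>e. e \<in> arcs G \<Longrightarrow> (x e has_real_derivative x' e) (at_right \<theta>)"
  shows "normalized_thin_flow N u0 (resetting_arcs N f \<theta>) (active_arcs N f \<theta>) x' l'"
proof -
  let ?label = "\<lambda>e. arc_label N (resetting_arcs N f \<theta>) e (l' (tail G e)) (x' e)"
  have arc: "e \<in> arcs G" if "e \<in> active_arcs N f \<theta>" for e
    using that by (simp add: active_arc_iff)
  have upper: "l' (head G e) \<le> ?label e" if "e \<in> active_arcs N f \<theta>" for e
    using arc[OF that] by (intro le_arc_label[OF that] l' x') auto
  have lower: "?label e \<le> l' (head G e)"
    if "e \<in> arcs G" "\<exists>\<^sub>F \<eta> in at_right \<theta>. e \<in> active_arcs N f \<eta>" for e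
    using that(1) by (intro arc_label_le[OF that] l' x') auto
  have "l' s = 1"
  proof (rule right_derivative_eq[OF l'[OF source_in_verts] DERIV_ident])
    show "\<forall>\<^sub>F y in at_right \<theta>. \<l> s y - \<l> s \<theta> = y - \<theta>"
      by (simp add: earliest_time_source)
  qed
  moreover have "l' w = Min {?label e | e. e \<in> active_arcs N f \<theta> \<and> head G e = w}"
    if w: "w \<in> verts G" "w \<noteq> s" for w
  proof (rule Min_eqI[symmetric])
    have "{?label e | e. e \<in> active_arcs N f \<theta> \<and> head G e = w} \<subseteq> ?label ` arcs G"
      by (auto simp: arc)
    then show "finite {?label e | e. e \<in> active_arcs N f \<theta> \<and> head G e = w}"
      by (rule finite_subset) simp
    show "l' w \<le> b" if "b \<in> {?label e | e. e \<in> active_arcs N f \<theta> \<and> head G e = w}" for b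
      using that upper by auto
    \<comment> \<open>Both bounds meet on an arc active at times accumulating at \<theta>, so the
      minimum is attained there.\<close>
    obtain e where e: "e \<in> arcs G" "head G e = w" "\<exists>\<^sub>F \<eta> in at_right \<theta>. e \<in> active_arcs N f \<eta>"
      using frequently_active_arc_exists[OF w] by blast
    have active: "e \<in> active_arcs N f \<theta>"
      using frequently_active_imp_active[OF e(3)] .
    then have "l' w = ?label e"
      using upper[OF active] lower[OF e(1,3)] e(2) by simp
    then show "l' w \<in> {?label e | e. e \<in> active_arcs N f \<theta> \<and> head G e = w}"
      using active e(2) by blast
  qed
  moreover have "x' e = 0"
    if e: "e \<in> active_arcs N f \<theta>" and less: "l' (head G e) < ?label e" for e
  proof -
    \<comment> \<open>The strict inequality contradicts \<open>lower\<close>, so \<open>e\<close> is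
      inactive on a right neighbourhood of \<theta>, where its cumulative flow is constant.\<close>
    have "\<not> (\<exists>\<^sub>F \<eta> in at_right \<theta>. e \<in> active_arcs N f \<eta>)"
      using lower[OF arc[OF e]] less by auto
    then show ?thesis
      using arc[OF e] by (intro eventually_inactive_imp_derivative_0[OF _ x']) (auto simp: frequently_def)
  qed
  moreover have "0 \<le> u0"
    by (rule mono_right_derivative_nonneg[OF _ u']) (rule cumulative_mono[OF inflow_rate])
  ultimately show ?thesis
    using resetting_configuration_active static_flow_right_derivative[OF u' x']
    by (auto simp: normalized_thin_flow_def corresponding_labels_def)
qed

end

theorem theorem7:
  fixes N :: "('v, 'e) fluid_network"
    and u :: "real \<Rightarrow> real"
    and f :: "'e flow_over_time"
    and \<theta> u0 :: real
    and l' :: "'v \<Rightarrow> real"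
    and x' :: "'e \<Rightarrow> real"
  assumes "valid_network N"
    and "u \<in> rate_functions"
    and "queues_at_capacity N f"
    and "dynamic_equilibrium N u f"
    and "(cumulative u has_real_derivative u0) (at_right \<theta>)"
    and "\<And>v. v \<in> verts (graph_of N) \<Longrightarrow>
           (earliest_time N f v has_real_derivative l' v) (at_right \<theta>)"
    and "\<And>e. e \<in> arcs (graph_of N) \<Longrightarrow>
           (cumulative_flow N f e has_real_derivative x' e) (at_right \<theta>)"
  shows "normalized_thin_flow N u0 (resetting_arcs N f \<theta>) (active_arcs N f \<theta>) x' l'"
proof -
  interpret equilibrium_flow N u f
    using assms(1-4) by unfold_locales (auto simp: dynamic_equilibrium_def)
  show ?thesis
    using assms(5-7) by (rule normalized_thin_flow_right_derivative)
qed

end
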